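(* Let a family of numerical corner fluxes $\hat{\mathbf{F}}_p\cdot\mathbf{n}_{pc}\in\mathbb{R}^m$ and a family of nodal fluctuations $\boldsymbol{\phi}_{pc}\in\mathbb{R}^m$ (for every vertex $p$ of the tessellation and every cell $c\in\mathcal{C}_p$) be related by $$\hat{\mathbf{F}}_p\cdot\mathbf{n}_{pc} = \mathbf{F}(\mathbf{Q}_c^n)\cdot\mathbf{n}_{pc} + \boldsymbol{\phi}_{pc}.$$ For each vertex $p$ set $$\boldsymbol{\phi}_p := \sum_{c\in\mathcal{C}_p}\mathbf{F}(\mathbf{Q}_c^n)\cdot\mathbf{n}_{cp}.$$ Then: (i) for each vertex $p$, the local conservation condition $\sum_{c\in\mathcal{C}_p}\hat{\mathbf{F}}_p\cdot\mathbf{n}_{pc}=0$ holds if and only if the fluctuations are a splitting of the residual $\boldsymbol{\phi}_p$, i.e. $\sum_{c\in\mathcal{C}_p}\boldsymbol{\phi}_{pc}=\boldsymbol{\phi}_p$; (ii) the first order finite volume scheme with corner fluxes coincides with the residual distribution scheme defined by the fluctuations, i.e. for every cell $\Omega_c$ $$\mathbf{Q}_c^n-\frac{\Delta t}{|\Omega_c|}\sum_{p\in\mathcal{P}_c}\hat{\mathbf{F}}_p\cdot\mathbf{n}_{pc} \;=\; \mathbf{Q}_c^n-\frac{\Delta t}{|\Omega_c|}\sum_{p\in\mathcal{P}_c}\boldsymbol{\phi}_{pc}.$$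
   Context: Consider a hyperbolic system of conservation laws $\partial_t\mathbf{Q}+\nabla\cdot\mathbf{F}(\mathbf{Q})=0$ in $d=2$ space dimensions, with $\mathbf{Q}\in\Omega_{\mathbf{Q}}\subset\mathbb{R}^m$ and flux tensor $\mathbf{F}=(\mathbf{f}_1,\dots,\mathbf{f}_d)$, $\mathbf{f}_i(\mathbf{Q})\in\mathbb{R}^m$. For $\mathbf{n}=(n_1,\dots,n_d)\in\mathbb{R}^d$ write $\mathbf{F}\cdot\mathbf{n}=\sum_i\mathbf{f}_i n_i\in\mathbb{R}^m$. Geometry: the domain is tessellated by Voronoi-like polygons $\Omega_c$ with area $|\Omega_c|$ such that every vertex $p$ is shared by exactly $d+1=3$ cells (boundary effects are disregarded, e.g. periodic boundary conditions). $\mathcal{C}_p$ is the set of cells meeting at $p$, and $\mathcal{P}_c$ is the set of vertices of $\Omega_c$. For two cells $\Omega_a,\Omega_c$ sharing an edge $\partial\Omega_{ac}$, $\mathbf{n}_{ac}$ is the normal to the edge pointing from $\Omega_c$ to $\Omega_a$, with length $|\partial\Omega_{ac}|$. If $\partial\Omega_{ac}$ and $\partial\Omega_{bc}$ are the two edges of $\Omega_c$ meeting at $p$, the corner normal is $\mathbf{n}_{pc}=\tfrac12(\mathbf{n}_{ac}+\mathbf{n}_{bc})$, and $\mathbf{n}_{cp}=-\mathbf{n}_{pc}$. $\mathbf{Q}_c^n\in\Omega_{\mathbf{Q}}$ is the (piecewise constant) discrete cell value at time level $n$ and $\Delta t>0$ is the time step. The first order finite volume scheme with corner fluxes is $\mathbf{Q}_c^{n+1}=\mathbf{Q}_c^n-\frac{\Delta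 t}{|\Omega_c|}\sum_{p\in\mathcal{P}_c}\hat{\mathbf{F}}_p\cdot\mathbf{n}_{pc}$, where for each $c\in\mathcal{C}_p$ the corner flux $\hat{\mathbf{F}}_p\cdot\mathbf{n}_{pc}$ is a vector in $\mathbb{R}^m$ depending on the $d+1$ states of the cells in $\mathcal{C}_p$ (no high order reconstruction is used). A residual distribution scheme here is an update $\mathbf{Q}_c^{n+1}=\mathbf{Q}_c^n-\frac{\Delta t}{|\Omega_c|}\sum_{p\in\mathcal{P}_c}\boldsymbol{\phi}_{pc}$ in which the fluctuations $\boldsymbol{\phi}_{pc}$, $c\in\mathcal{C}_p$, split the residual $\boldsymbol{\phi}_p$. *)

theory Defs
  imports "HOL-Analysis.Analysis"
begin

section \<open>Conservation laws\<close>

text \<open>A flux tensor \<open>A = (f\<^sub>1, \<dots>, f\<^sub>d)\<close> is a \<^typ>\<open>real^'m^'d\<close> whose component \<open>A $ i\<close> is the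
  vector \<open>f\<^sub>i\<close>.\<close>

definition flux_dot :: "real^'m^'d \<Rightarrow> real^'d \<Rightarrow> real^'m"  (infixl \<open>\<bullet>\<^sub>F\<close> 70)
  where "A \<bullet>\<^sub>F n = (\<Sum>i\<in>UNIV. (n $ i) *\<^sub>R (A $ i))"

text \<open>Hyperbolicity of \<open>\<partial>\<^sub>t Q + div F(Q) = 0\<close> on a set of states: every directional Jacobian has a
  complete set of real eigenvectors.\<close>

definition hyperbolic_system :: "(real^'m) set \<Rightarrow> (real^'m \<Rightarrow> real^'m^'d) \<Rightarrow> bool"
  where "hyperbolic_system S F \<longleftrightarrow>
    (\<forall>q\<in>S. \<exists>J :: 'd \<Rightarrow> real^'m^'m.
       (\<forall>i. ((\<lambda>u. F u $ i) has_derivative (\<lambda>v. J i *v v)) (at q within S)) \<and>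
       (\<forall>n :: real^'d. span {v. \<exists>l :: real. (\<Sum>i\<in>UNIV. (n $ i) *\<^sub>R J i) *v v = l *\<^sub>R v} = UNIV))"

section \<open>Polygons\<close>

text \<open>A polygon is given by the cyclic list of its vertices, in either orientation.\<close>

definition side :: "(real^2) list \<Rightarrow> nat \<Rightarrow> (real^2) set"
  where "side vs i = closed_segment (vs ! i) (vs ! (Suc i mod length vs))"

definition edges :: "(real^2) list \<Rightarrow> (real^2) set set"
  where "edges vs = side vs ` {..<length vs}"

text \<open>The intersection condition says that different sides meet only in common endpoints.  An angle
  of 180 degrees at a vertex is allowed, and convexity is not required.\<close>

definition simple_polygon :: "(real^2) list \<Rightarrow> bool"
  where "simple_polygon vs \<longleftrightarrow>
    3 \<le> length vs \<and> distinct vs \<and>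
    (\<forall>i<length vs. \<forall>j<length vs. i \<noteq> j \<longrightarrow>
       side vs i \<inter> side vs j =
         {vs ! i, vs ! (Suc i mod length vs)} \<inter> {vs ! j, vs ! (Suc j mod length vs)})"

definition region :: "(real^2) list \<Rightarrow> (real^2) set"
  where "region vs = \<Union>(edges vs) \<union> inside (\<Union>(edges vs))"

section \<open>Tessellations\<close>

text \<open>The cells are indexed by the type \<^typ>\<open>'c\<close>, and the cell \<open>c\<close> is the closed polygon
  \<open>region (vs c)\<close>.  To have no boundary the cells tessellate the whole plane; a mesh with
  periodic boundary conditions is such a tessellation (with periodic data) after lifting it from the
  torus to the plane.\<close>

definition vertices :: "('c \<Rightarrow> (real^2) list) \<Rightarrow> (real^2) set"
  where "vertices vs = (\<Union>c. set (vs c))"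

definition cells_at :: "('c \<Rightarrow> (real^2) list) \<Rightarrow> real^2 \<Rightarrow> 'c set"
  where "cells_at vs p = {c. p \<in> region (vs c)}"

definition area :: "('c \<Rightarrow> (real^2) list) \<Rightarrow> 'c \<Rightarrow> real"
  where "area vs c = measure lebesgue (region (vs c))"

locale polygonal_tessellation =
  fixes vs :: "'c \<Rightarrow> (real^2) list"
  assumes polygon: "simple_polygon (vs c)"
    and covering: "(\<Union>c. region (vs c)) = UNIV"
    and non_overlapping: "a \<noteq> c \<Longrightarrow> interior (region (vs a)) \<inter> interior (region (vs c)) = {}"
    and locally_finite: "compact K \<Longrightarrow> finite {c. region (vs c) \<inter> K \<noteq> {}}"
    and no_hanging_vertex: "p \<in> vertices vs \<Longrightarrow> c \<in> cells_at vs p \<Longrightarrow> p \<in> set (vs c)"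
    and edge_to_edge: "e \<in> edges (vs c) \<Longrightarrow> \<exists>!a. a \<noteq> c \<and> e \<in> edges (vs a)"
    and three_cells: "p \<in> vertices vs \<Longrightarrow> card (cells_at vs p) = 3"

text \<open>The normal \<open>n\<^sub>a\<^sub>c\<close> to the common edge \<open>e\<close> of \<open>a\<close> and \<open>c\<close>, with the length of \<open>e\<close> and pointing
  from \<open>c\<close> to \<open>a\<close>.  The edge is an explicit argument since two nonconvex cells can share several
  edges.\<close>

definition edge_normal :: "('c \<Rightarrow> (real^2) list) \<Rightarrow> (real^2) set \<Rightarrow> 'c \<Rightarrow> 'c \<Rightarrow> real^2"
  where "edge_normal vs e a c = (THE n.
    (\<forall>x\<in>e. \<forall>y\<in>e. n \<bullet> (x - y) = 0) \<and>
    norm n = diameter e \<and>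
    (\<forall>x\<in>rel_interior e. eventually
       (\<lambda>t. x + t *\<^sub>R n \<in> region (vs a) \<and> x - t *\<^sub>R n \<in> region (vs c)) (at_right 0)))"

text \<open>For a vertex \<open>p\<close> of \<open>c\<close> the sum below has two terms, one for each edge of \<open>c\<close> meeting at \<open>p\<close>.
  \<open>corner_normal vs p c\<close> is \<open>n\<^sub>p\<^sub>c\<close>, and \<open>corner_normal' vs c p\<close> is \<open>n\<^sub>c\<^sub>p\<close>.\<close>

definition corner_normal :: "('c \<Rightarrow> (real^2) list) \<Rightarrow> real^2 \<Rightarrow> 'c \<Rightarrow> real^2"
  where "corner_normal vs p c = (1/2) *\<^sub>R
    (\<Sum>(a, e) \<in> {(a, e). a \<noteq> c \<and> e \<in> edges (vs a) \<inter> edges (vs c) \<and> p \<in> e}. edge_normal vs e a c)"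

definition corner_normal' :: "('c \<Rightarrow> (real^2) list) \<Rightarrow> 'c \<Rightarrow> real^2 \<Rightarrow> real^2"
  where "corner_normal' vs c p = - corner_normal vs p c"

definition residual ::
    "('c \<Rightarrow> (real^2) list) \<Rightarrow> (real^'m \<Rightarrow> real^'m^2) \<Rightarrow> ('c \<Rightarrow> real^'m) \<Rightarrow> real^2 \<Rightarrow> real^'m"
  where "residual vs F Q p = (\<Sum>c\<in>cells_at vs p. F (Q c) \<bullet>\<^sub>F corner_normal' vs c p)"

end

(* For (ii), linearity of the corner flux in the normal reduces the claim to the vanishing of the sum
   of the corner normals of a cell. Every edge of the cell occurs at exactly two of its corners, so
   this sum is the sum of the outward normals of the edges. The outward normals are the edge vectors
   rotated by a right angle, all in the same direction, and hence they sum to zero.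

   The same direction works for all edges because the winding number of the boundary jumps by 1 from
   the right to the left of each edge, while it is 0 outside and constantly 1 or constantly -1
   inside. *)

theory Submission
  imports Defs "HOL-Complex_Analysis.Winding_Numbers"
begin

section \<open>Closed polygonal paths in the complex plane\<close>

text \<open>The real part of the winding number is the signed angle at \<open>z\<close> divided by 2
  pi. It is positive because \<open>z\<close> is to the left of the segment, and an obtuse angle is
  more than a quarter turn.\<close>

lemma winding_number_linepath_obtuse:
  assumes left: "0 < Im ((b - a) * cnj (b - z))" and obtuse: "(a - z) \<bullet> (b - z) < 0"
  shows "1/4 < Re (winding_number (linepath a b) z)"
    "z \<notin> closed_segment a b"
proof -
  show z: "z \<notin> closed_segment a b"
    using left by (simp add: closed_segment_def) (force simp: algebra_simps)
  \<comment> \<open>The obtuse angle at \<^term>\<open>z\<close> makes the cosine of \<open>2 \<pi> Re w\<close> negative.\<close>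
  define w where "w = winding_number (linepath a b) z"
  have pos: "0 < Re w"
    using winding_number_linepath_pos_lt[OF left] by (simp add: w_def)
  have eq: "b - z = exp (2 * pi * \<i> * w) * (a - z)"
    using winding_number_exp_2pi[of "linepath a b" z] z by (simp add: w_def)
  have inner_mult: "u \<bullet> (k * u) = Re k * (norm u)\<^sup>2" for u k :: complex
    by (simp add: inner_complex_def cmod_def power2_eq_square algebra_simps)
  have "(a - z) \<bullet> (b - z) = Re (exp (2 * pi * \<i> * w)) * (norm (a - z))\<^sup>2"
    by (simp only: eq inner_mult)
  with obtuse have "Re (exp (2 * pi * \<i> * w)) < 0"
    by (simp add: mult_less_0_iff not_less)
  then have cos: "cos (2 * pi * Re w) < 0"
    by (simp add: Re_exp mult_less_0_iff)
  show "1/4 < Re (winding_number (linepath a b) z)"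
  proof (rule ccontr)
    assume "\<not> ?thesis"
    then have "2 * pi * Re w \<le> pi / 2"
      by (simp add: w_def)
    moreover have "- (pi / 2) \<le> 2 * pi * Re w"
      using pos by (smt (verit) mult_pos_pos pi_gt_zero pi_half_gt_zero)
    ultimately have "0 \<le> cos (2 * pi * Re w)" 
      by (intro cos_ge_zero) auto
    with cos show False by simp
  qed
qed

section \<open>Paths through a sequence of points\<close>

text \<open>There are k + 1 segments, so no empty path arises. With vertices given by a function,
  closing the path is just the equation \<open>v (Suc k) = v 0\<close>.\<close>

fun polypath :: "(nat \<Rightarrow> complex) \<Rightarrow> nat \<Rightarrow> real \<Rightarrow> complex" where
  "polypath v 0 = linepath (v 0) (v 1)"
| "polypath v (Suc k) = polypath v k +++ linepath (v (Suc k)) (v (Suc (Suc k)))"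

lemma polypath_props [simp]:
  "pathstart (polypath v k) = v 0" "pathfinish (polypath v k) = v (Suc k)"
  "path (polypath v k)"
  by (induction k) auto

lemma path_image_polypath:
  "path_image (polypath v k) = (\<Union>i\<le>k. closed_segment (v i) (v (Suc i)))"
  by (induction k) (auto simp: path_image_join atMost_Suc)

lemma winding_number_polypath:
  assumes "z \<notin> path_image (polypath v k)"
  shows "winding_number (polypath v k) z = (\<Sum>i\<le>k. winding_number (linepath (v i) (v (Suc i))) z)"
  using assms
  by (induction k) (auto simp: path_image_join winding_number_join)

lemma arc_polypath:
  assumes "inj_on v {..Suc k}"
    and "\<And>i j. i < j \<Longrightarrow> j \<le> k \<Longrightarrow> closed_segment (v i) (v (Suc i)) \<inter> closed_segment (v j) (v (Suc j))
           \<subseteq> {v i, v (Suc i)} \<inter> {v j, v (Suc j)}"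
  shows "arc (polypath v k)"
  using assms
proof (induction k)
  case 0
  have "v 0 \<noteq> v 1" using inj_onD[OF 0(1), of 0 1] by auto
  then show ?case by simp
next
  case (Suc k)
  have inj: "inj_on v {..Suc k}"
    by (rule inj_on_subset[OF Suc.prems(1)]) auto
  have ne: "v i \<noteq> v j" if "i < j" "j \<le> Suc (Suc k)" for i j
    using inj_onD[OF Suc.prems(1), of i j] that by auto
  have "arc (polypath v k)"
    by (rule Suc.IH[OF inj]) (use Suc.prems(2) in auto)
  moreover have "path_image (polypath v k) \<inter> closed_segment (v (Suc k)) (v (Suc (Suc k))) \<subseteq> {v (Suc k)}"
  proof -
    have "closed_segment (v i) (v (Suc i)) \<inter> closed_segment (v (Suc k)) (v (Suc (Suc k))) \<subseteq> {v (Suc k)}"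
      if "i \<le> k" for i
      using Suc.prems(2)[of i "Suc k"] ne[of i "Suc (Suc k)"] ne[of "Suc i" "Suc (Suc k)"] that by auto
    then show ?thesis
      by (auto simp: path_image_polypath)
  qed
  ultimately show ?case
    using ne[of "Suc k" "Suc (Suc k)"] by (auto intro!: arc_join)
qed

text \<open>All segments but the last form an arc; the last one returns to \<open>v 0\<close> and
  meets this arc only in its two endpoints.\<close>

lemma simple_path_polypath:
  assumes inj: "inj_on v {..Suc k}" and closed: "v (Suc (Suc k)) = v 0"
    and inter: "\<And>i j. i < j \<Longrightarrow> j \<le> Suc k \<Longrightarrow> closed_segment (v i) (v (Suc i)) \<inter> closed_segment (v j) (v (Suc j))
           \<subseteq> {v i, v (Suc i)} \<inter> {v j, v (Suc j)}"
  shows "simple_path (polypath v (Suc k))"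
proof -
  have ne: "v 0 \<noteq> v (Suc k)"
    using inj_onD[OF inj, of 0 "Suc k"] by auto
  have "arc (polypath v k)"
    by (rule arc_polypath) (use inj inter in auto)
  moreover have "path_image (polypath v k) \<inter> closed_segment (v (Suc k)) (v 0) \<subseteq> {v 0, v (Suc k)}"
  proof -
    have "closed_segment (v i) (v (Suc i)) \<inter> closed_segment (v (Suc k)) (v 0) \<subseteq> {v 0, v (Suc k)}"
      if "i \<le> k" for i
      using inter[of i "Suc k"] that by (auto simp: closed)
    then show ?thesis
      by (auto simp: path_image_polypath)
  qed
  ultimately show ?thesis
    using ne by (auto intro!: simple_path_join_loop simp: closed)
qed

section \<open>The side of each segment on which the inside lies\<close>

text \<open>The sign \<open>s\<close> is the winding number about inside points. It is fixed before
  a segment is chosen, which makes the choice between left and right the same for all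
  segments.\<close>

lemma polypath_inside_side:
  assumes simple: "simple_path (polypath v k)" and closed: "v (Suc k) = v 0"
  obtains s :: real where "s \<in> {1, -1}"
    and "\<And>i x. i \<le> k \<Longrightarrow> x \<in> open_segment (v i) (v (Suc i)) \<Longrightarrow>
      (\<And>j. j \<le> k \<Longrightarrow> j \<noteq> i \<Longrightarrow> x \<notin> closed_segment (v j) (v (Suc j))) \<Longrightarrow>
      \<forall>\<^sub>F t in at_right 0.
        x + t *\<^sub>R (s *\<^sub>R (\<i> * (v (Suc i) - v i))) \<in> inside (path_image (polypath v k)) \<and>
        x - t *\<^sub>R (s *\<^sub>R (\<i> * (v (Suc i) - v i))) \<in> outside (path_image (polypath v k))"
proof -
  define P where "P = path_image (polypath v k)"
  define W where "W = winding_number (polypath v k)"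
  obtain s :: real where s: "s \<in> {1, -1}" and W_in: "\<And>z. z \<in> inside P \<Longrightarrow> W z = of_real s"
    by (rule simple_closed_path_winding_number_inside[OF simple])
       (metis P_def W_def insertCI of_real_1 of_real_minus)+
  have W_out: "W z = 0" if "z \<in> outside P" for z
    using winding_number_zero_in_outside that closed by (auto simp: P_def W_def)
  have in_or_out: "z \<in> inside P \<or> z \<in> outside P" if "z \<notin> P" for z
    using that by (metis ComplI UnE inside_Un_outside)
  have "\<forall>\<^sub>F t in at_right 0.
        x + t *\<^sub>R (s *\<^sub>R (\<i> * (v (Suc i) - v i))) \<in> inside P \<and>
        x - t *\<^sub>R (s *\<^sub>R (\<i> * (v (Suc i) - v i))) \<in> outside P"
    if i: "i \<le> k" and x: "x \<in> open_segment (v i) (v (Suc i))"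
      and only: "\<And>j. j \<le> k \<Longrightarrow> j \<noteq> i \<Longrightarrow> x \<notin> closed_segment (v j) (v (Suc j))" for i x
  proof -
    define a where "a = v i"
    define b where "b = v (Suc i)"
    define n where "n = \<i> * (b - a)"
    define J where "J = {..k} - {i}"
    \<comment> \<open>The contribution of the other segments is continuous at \<open>x\<close>,
      which lies on none of them.\<close>
    define R where "R z = (\<Sum>j\<in>J. winding_number (linepath (v j) (v (Suc j))) z)" for z
    obtain u where u: "0 < u" "u < 1" "x = (1 - u) *\<^sub>R a + u *\<^sub>R b" and ab: "a \<noteq> b"
      using x by (auto simp: in_segment a_def b_def)
    have x_minus: "a - x = - (of_real u * (b - a))" "b - x = of_real (1 - u) * (b - a)"
      by (auto simp: u(3) scaleR_conv_of_real algebra_simps)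
    \<comment> \<open>From \<open>x\<close> itself the endpoints are seen in opposite directions, so
      the angle stays obtuse nearby.\<close>
    have obtuse_x: "(a - x) \<bullet> (b - x) < 0"
    proof -
      have "(a - x) \<bullet> (b - x) = - (u * (1 - u)) * (norm (b - a))\<^sup>2"
        unfolding x_minus scaleR_conv_of_real[symmetric] by (simp add: power2_norm_eq_inner del: scaleR_conv_of_real)
      then show ?thesis
        using u ab by (simp add: mult_pos_pos)
    qed
    \<comment> \<open>The factor \<open>r\<close> will be 1 and -1, for the points on the two sides
      of the segment.\<close>
    have lim: "((\<lambda>t. x + (r * t) *\<^sub>R n) \<longlongrightarrow> x) (at_right 0)" for r
      by (auto intro!: tendsto_eq_intros)
    have obtuse: "\<forall>\<^sub>F t in at_right 0. (a - (x + (r * t) *\<^sub>R n)) \<bullet> (b - (x + (r * t) *\<^sub>R n)) < 0" for r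
    proof -
      have "((\<lambda>t. (a - (x + (r * t) *\<^sub>R n)) \<bullet> (b - (x + (r * t) *\<^sub>R n))) \<longlongrightarrow> (a - x) \<bullet> (b - x)) (at_right 0)"
        by (intro tendsto_intros lim)
      then show ?thesis
        using obtuse_x by (rule order_tendstoD)
    qed
    have avoid: "\<forall>\<^sub>F t in at_right 0. \<forall>j\<in>J. x + (r * t) *\<^sub>R n \<notin> closed_segment (v j) (v (Suc j))" for r
    proof (rule eventually_ball_finite)
      show "\<forall>j\<in>J. \<forall>\<^sub>F t in at_right 0. x + (r * t) *\<^sub>R n \<notin> closed_segment (v j) (v (Suc j))"
        using only topological_tendstoD[OF lim, of "- closed_segment (v j) (v (Suc j))" for j]
        by (auto simp: J_def open_Compl)
    qed (simp add: J_def)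
    have R_lim: "((\<lambda>t. R (x + (r * t) *\<^sub>R n)) \<longlongrightarrow> R x) (at_right 0)" for r
      unfolding R_def
    proof (intro tendsto_sum isCont_tendsto_compose[OF _ lim])
      show "isCont (winding_number (linepath (v j) (v (Suc j)))) x" if "j \<in> J" for j
        using that only by (intro continuous_at_winding_number) (auto simp: J_def)
    qed
    \<comment> \<open>The segment itself will contribute a jump above 1/4 + 1/4, so a change below
      1/4 in the rest leaves it positive.\<close>
    have R_small: "\<forall>\<^sub>F t in at_right 0. \<bar>Re (R (x + (1 * t) *\<^sub>R n)) - Re (R (x + (-1 * t) *\<^sub>R n))\<bar> < 1/4"
    proof -
      have "((\<lambda>t. \<bar>Re (R (x + (1 * t) *\<^sub>R n)) - Re (R (x + (-1 * t) *\<^sub>R n))\<bar>) \<longlongrightarrow> \<bar>Re (R x) - Re (R x)\<bar>)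
              (at_right 0)"
        by (intro tendsto_intros R_lim)
      then show ?thesis
        by (rule order_tendstoD) simp
    qed
    have pos: "\<forall>\<^sub>F t in at_right 0. 0 < (t::real)"
      by (simp add: eventually_at_filter)
    show ?thesis
      using pos R_small avoid[of 1] avoid[of "-1"] obtuse[of 1] obtuse[of "-1"]
    proof eventually_elim
      case (elim t)
      define z where "z = x + t *\<^sub>R n"
      define z' where "z' = x - t *\<^sub>R n"
      define L where "L = winding_number (linepath a b)"
      \<comment> \<open>The point \<open>z'\<close> is on the left of the reversed segment from
        \<open>b\<close> to \<open>a\<close>, so the same lemma serves both points.\<close>
      have left: "0 < Im ((b - a) * cnj (b - z))" and right: "0 < Im ((a - b) * cnj (a - z'))"
      proof -
        have Im_rotated: "Im (d * cnj ((of_real r - of_real t * \<i>) * d)) = t * (norm d)\<^sup>2" for d r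
          unfolding cmod_power2 by (simp add: power2_eq_square algebra_simps)
        have "b - z = (of_real (1 - u) - of_real t * \<i>) * (b - a)"
          using x_minus(2) by (simp add: z_def n_def scaleR_conv_of_real algebra_simps)
        then show "0 < Im ((b - a) * cnj (b - z))"
          using elim(1) ab by (simp only: Im_rotated) simp
        have "a - z' = (of_real u - of_real t * \<i>) * (a - b)"
          using x_minus(1) by (simp add: z'_def n_def scaleR_conv_of_real algebra_simps)
        then show "0 < Im ((a - b) * cnj (a - z'))"
          using elim(1) ab by (simp only: Im_rotated) simp
      qed
      have L: "1/4 < Re (L z)" "z \<notin> closed_segment a b"
        using winding_number_linepath_obtuse[OF left] elim(5) by (auto simp: z_def L_def)
      have L': "Re (L z') < -1/4" "z' \<notin> closed_segment a b"
      proof -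
        note * = winding_number_linepath_obtuse[OF right]
        have ob: "(b - z') \<bullet> (a - z') < 0"
          using elim(6) by (simp add: z'_def inner_commute)
        show nz: "z' \<notin> closed_segment a b"
          using *(2)[OF ob] by (simp add: closed_segment_commute)
        have "L z' = - winding_number (linepath b a) z'"
          using winding_number_reversepath[of "linepath b a" z'] nz
          by (simp add: L_def closed_segment_commute)
        then show "Re (L z') < -1/4"
          using *(1)[OF ob] by auto
      qed
      have off: "y \<notin> P" and split: "W y = L y + R y"
        if "y \<notin> closed_segment a b" "\<forall>j\<in>J. y \<notin> closed_segment (v j) (v (Suc j))" for y
      proof -
        show "y \<notin> P"
          using that by (auto simp: P_def path_image_polypath J_def a_def b_def)
        then have "W y = (\<Sum>j\<le>k. winding_number (linepath (v j) (v (Suc j))) y)"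
          by (simp add: W_def P_def winding_number_polypath)
        also have "\<dots> = L y + R y"
          using i by (simp add: R_def J_def L_def a_def b_def sum.remove)
        finally show "W y = L y + R y" .
      qed
      have z_off: "\<forall>j\<in>J. z \<notin> closed_segment (v j) (v (Suc j))"
        and z'_off: "\<forall>j\<in>J. z' \<notin> closed_segment (v j) (v (Suc j))"
        using elim(3,4) by (auto simp: z_def z'_def)
      have "\<bar>Re (R z) - Re (R z')\<bar> < 1/4"
        using elim(2) by (simp add: z_def z'_def)
      \<comment> \<open>Both values of \<^term>\<open>W\<close> are \<open>0\<close> or \<^term>\<open>s\<close>, so any positive lower bound shows
        that the jump is \<open>1\<close>.\<close>
      then have jump: "1/4 < Re (W z) - Re (W z')"
        using L(1) L'(1) unfolding split[OF L(2) z_off] split[OF L'(2) z'_off] plus_complex.sel by linarith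
      consider "s = 1" | "s = -1" using s by auto
      \<comment> \<open>A positive jump forces the values of \<open>W\<close> at \<open>z\<close>
        and \<open>z'\<close> to be 1 and 0 if \<open>s = 1\<close>, and 0 and -1 if
        \<open>s = -1\<close>.\<close>
      then have "if s = 1 then z \<in> inside P \<and> z' \<in> outside P else z' \<in> inside P \<and> z \<in> outside P"
        using jump W_in[of z] W_in[of z'] W_out[of z] W_out[of z']
          in_or_out[OF off[OF L(2) z_off]] in_or_out[OF off[OF L'(2) z'_off]]
        by cases auto
      then show ?case
        using s by (auto simp: z_def z'_def n_def a_def b_def)
    qed
  qed
  with s that show ?thesis
    unfolding P_def by blast
qed

section \<open>Insides under linear bijections\<close>

text \<open>A point is inside if its component of the complement is bounded. The map carries
  components to components, and it and its inverse preserve boundedness.\<close>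

lemma inside_homeomorphism_image:
  assumes f: "bij f" "bounded_linear f" and g: "bounded_linear (inv f)"
  shows "inside (f ` S) = f ` inside S"
proof -
  have fg: "f (inv f y) = y" "inv f (f x) = x" for x y
    using f(1) by (simp_all add: bij_is_surj surj_f_inv_f bij_is_inj)
  have compl: "- (f ` S) = f ` (- S)"
    using f(1) by (simp add: bij_image_Compl_eq)
  have homeo: "homeomorphism (- S) (f ` (- S)) f (inv f)"
    unfolding homeomorphism_def
    using f(2) g by (auto simp: fg image_image linear_continuous_on)
  have component: "connected_component_set (f ` (- S)) (f x) = f ` connected_component_set (- S) x"
    if "x \<notin> S" for x
    by (rule connected_component_set_homeomorphism[OF homeo]) (use that in auto)
  have bounded: "bounded (f ` T) \<longleftrightarrow> bounded T" for T
    using bounded_linear_image[OF _ f(2)] bounded_linear_image[OF _ g, of "f ` T"]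
    by (auto simp: image_image fg)
  have "f x \<in> inside (f ` S) \<longleftrightarrow> x \<in> inside S" for x
    using component[of x] f(1)
    by (auto simp: inside_def compl bounded inj_image_mem_iff bij_is_inj)
  then show ?thesis
    using fg(1) by (auto simp: image_iff) metis+
qed

section \<open>Outward normals of a simple polygon\<close>

definition to_complex :: "real^2 \<Rightarrow> complex" where
  "to_complex x = Complex (x $ 1) (x $ 2)"

definition rot90 :: "real^2 \<Rightarrow> real^2" where
  "rot90 x = vector [- (x $ 2), x $ 1]"

lemma linear_to_complex: "linear to_complex"
  by (rule linearI) (auto simp: to_complex_def complex_eq_iff)

lemma to_complex_inverse: "to_complex (vector [Re z, Im z]) = z" "vector [Re (to_complex x), Im (to_complex x)] = x"
  by (auto simp: to_complex_def complex_eq_iff vec_eq_iff forall_2)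

lemma bij_to_complex: "bij to_complex"
  by (rule bijI'; metis to_complex_inverse)

lemma inj_to_complex: "inj to_complex"
  using bij_to_complex by (rule bij_is_inj)

lemma linear_rot90: "linear rot90"
  by (rule linearI) (auto simp: rot90_def vec_eq_iff forall_2)

lemma to_complex_rot90: "to_complex (rot90 x) = \<i> * to_complex x"
  by (simp add: to_complex_def rot90_def complex_eq_iff)

lemma norm_rot90: "norm (rot90 x) = norm x"
  by (simp add: norm_eq_sqrt_inner inner_vec_def sum_2 rot90_def add.commute)

lemma inner_rot90: "rot90 x \<bullet> x = 0"
  by (simp add: inner_vec_def sum_2 rot90_def)

lemma inside_to_complex_image: "inside (to_complex ` S) = to_complex ` inside S"
proof (rule inside_homeomorphism_image)
  show "bij to_complex" by (rule bij_to_complex)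
  show "bounded_linear to_complex"
    by (rule linear_conv_bounded_linear[THEN iffD1, OF linear_to_complex])
  have "inv to_complex = (\<lambda>z. vector [Re z, Im z])"
    by (rule inv_equality) (simp_all add: to_complex_inverse)
  moreover have "linear (\<lambda>z. vector [Re z, Im z] :: real^2)"
    by (rule linearI) (auto simp: vec_eq_iff forall_2)
  ultimately show "bounded_linear (inv to_complex)"
    by (simp add: linear_conv_bounded_linear)
qed

section \<open>Segments and their normals in the plane\<close>

lemma diameter_closed_segment:
  fixes a b :: "'a::euclidean_space"
  shows "diameter (closed_segment a b) = norm (b - a)"
proof (rule antisym)
  show "diameter (closed_segment a b) \<le> norm (b - a)"
  proof (rule diameter_le)
    fix x y assume x: "x \<in> closed_segment a b" and y: "y \<in> closed_segment a b"
    show "norm (x - y) \<le> norm (b - a)"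
      using segment_furthest_le[OF y, of x] segment_bound[OF x] by auto
  qed simp
  show "norm (b - a) \<le> diameter (closed_segment a b)"
    using diameter_bounded_bound[of "closed_segment a b" b a] compact_imp_bounded[OF compact_segment[of a b]]
    by (simp add: dist_norm)
qed

text \<open>In the plane the vectors orthogonal to \<open>d\<close> form the line spanned by
  \<open>rot90 d\<close>, so the norm determines such a vector up to sign.\<close>

lemma orthogonal_real2_unique:
  fixes d m n :: "real^2"
  assumes "d \<noteq> 0" "m \<bullet> d = 0" "n \<bullet> d = 0" "norm m = norm n"
  shows "m = n \<or> m = - n"
proof -
  have parallel: "\<exists>r. k = r *\<^sub>R rot90 d" if "k \<bullet> d = 0" for k
  proof -
    have "(d $ 1)\<^sup>2 + (d $ 2)\<^sup>2 \<noteq> 0"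
      using \<open>d \<noteq> 0\<close> by (auto simp: vec_eq_iff forall_2 sum_power2_eq_zero_iff)
    moreover have "k $ 1 * d $ 1 + k $ 2 * d $ 2 = 0"
      using that by (simp add: inner_vec_def sum_2)
    \<comment> \<open>The coefficient is the inner product of \<open>k\<close> with
      \<open>rot90 d\<close>, divided by the squared norm of \<open>d\<close>.\<close>
    ultimately have "k = ((k $ 2 * d $ 1 - k $ 1 * d $ 2) / ((d $ 1)\<^sup>2 + (d $ 2)\<^sup>2)) *\<^sub>R rot90 d"
      by (simp add: vec_eq_iff forall_2 rot90_def divide_simps power2_eq_square) algebra
    then show ?thesis ..
  qed
  obtain r q where "m = r *\<^sub>R rot90 d" "n = q *\<^sub>R rot90 d"
    using parallel assms(2,3) by metis
  with assms(1,4) show ?thesis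
    by (auto simp: norm_rot90 abs_eq_iff)
qed

text \<open>A variant of the condition in \<open>edge_normal\<close> that refers to one polygon
  only. Asking for \<open>inside\<close> instead of \<open>region\<close> on the inner side gives
  open sets, so that two polygons on the same side of an edge have overlapping interiors.\<close>

definition outward_normal :: "(real^2) list \<Rightarrow> (real^2) set \<Rightarrow> real^2 \<Rightarrow> bool" where
  "outward_normal vs e n \<longleftrightarrow> (\<forall>x\<in>e. \<forall>y\<in>e. n \<bullet> (x - y) = 0) \<and> norm n = diameter e \<and>
    (\<forall>x\<in>rel_interior e. \<forall>\<^sub>F t in at_right 0.
       x + t *\<^sub>R n \<notin> region vs \<and> x - t *\<^sub>R n \<in> inside (\<Union>(edges vs)))"

lemma outward_normal_eventually:
  assumes "outward_normal vs e n" "x \<in> rel_interior e"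
  shows "\<forall>\<^sub>F t in at_right 0. x - t *\<^sub>R n \<in> inside (\<Union>(edges vs))"
    and "\<forall>\<^sub>F t in at_right 0. x + t *\<^sub>R n \<notin> region vs"
  using assms by (auto simp: outward_normal_def eventually_conj_iff)

lemma finite_edges: "finite (edges vs)"
  by (simp add: edges_def)

section \<open>Sides and vertices of a simple polygon\<close>

context
  fixes vs :: "(real^2) list"
  assumes polygon: "simple_polygon vs"
begin

lemma sides_Int:
  assumes "i < length vs" "j < length vs" "i \<noteq> j"
  shows "side vs i \<inter> side vs j =
    {vs ! i, vs ! (Suc i mod length vs)} \<inter> {vs ! j, vs ! (Suc j mod length vs)}"
  using polygon assms unfolding simple_polygon_def by meson

lemma side_endpoints_ne:
  assumes "i < length vs"
  shows "vs ! i \<noteq> vs ! (Suc i mod length vs)"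
proof -
  have "3 \<le> length vs" using polygon by (simp add: simple_polygon_def)
  moreover from this have "Suc i mod length vs \<noteq> i"
    using assms by (cases "Suc i = length vs") auto
  moreover have "Suc i mod length vs < length vs"
    using assms by (intro mod_less_divisor) auto
  ultimately show ?thesis
    using polygon assms nth_eq_iff_index_eq[of vs i "Suc i mod length vs"]
    by (simp add: simple_polygon_def)
qed

lemma open_side_disjoint:
  assumes "i < length vs" "j < length vs" "i \<noteq> j"
    and x: "x \<in> open_segment (vs ! i) (vs ! (Suc i mod length vs))"
  shows "x \<notin> side vs j"
proof
  assume "x \<in> side vs j"
  moreover have "x \<in> side vs i"
    using x by (simp add: side_def open_segment_def)
  ultimately have "x \<in> {vs ! i, vs ! (Suc i mod length vs)}"
    using sides_Int[OF assms(1-3)] by blast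
  then show False
    using x by (auto simp: open_segment_def)
qed

text \<open>A point in the open segment of one side lies on no other side. This lets sums over
  edges, which are sets, become sums over indices.\<close>

lemma inj_on_side: "inj_on (side vs) {..<length vs}"
proof (rule inj_onI, rule ccontr)
  fix i j assume ij: "i \<in> {..<length vs}" "j \<in> {..<length vs}" "side vs i = side vs j" "i \<noteq> j"
  obtain x where x: "x \<in> open_segment (vs ! i) (vs ! (Suc i mod length vs))"
    using side_endpoints_ne ij(1) by (metis ex_in_conv lessThan_iff open_segment_eq_empty)
  then have "x \<in> side vs j"
    unfolding ij(3)[symmetric] by (simp add: side_def open_segment_def)
  then show False
    using open_side_disjoint[OF _ _ _ x] ij by auto
qed

text \<open>Each vertex lies on the side that starts at it, so the intersection condition makes it
  an endpoint of any other side containing it.\<close>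

lemma vertices_on_side:
  assumes "i < length vs"
  shows "{p \<in> set vs. p \<in> side vs i} = {vs ! i, vs ! (Suc i mod length vs)}"
proof -
  have next_vertex: "vs ! (Suc i mod length vs) \<in> set vs"
    using assms by (intro nth_mem mod_less_divisor) auto
  have "vs ! j \<in> {vs ! i, vs ! (Suc i mod length vs)}" if j: "j < length vs" "vs ! j \<in> side vs i" for j
  proof (cases "j = i")
    case False
    have "vs ! j \<in> side vs j" by (simp add: side_def)
    with False j assms sides_Int[of j i] show ?thesis
      by blast
  qed simp
  then show ?thesis
    using assms next_vertex by (fastforce simp: in_set_conv_nth side_def)
qed

lemma card_vertices_on_edge:
  assumes "e \<in> edges vs"
  shows "card {p \<in> set vs. p \<in> e} = 2"
proof -
  obtain i where "i < length vs" "e = side vs i"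
    using assms by (auto simp: edges_def)
  then show ?thesis
    using vertices_on_side side_endpoints_ne by simp
qed

section \<open>Outward normals of a polygon and their sum\<close>

lemma open_inside_polygon: "open (inside (\<Union>(edges vs)))"
  using finite_edges by (intro open_inside closed_Union) (auto simp: edges_def side_def)

text \<open>This is \<open>polypath_inside_side\<close> carried over to \<open>real^2\<close>, where
  multiplication by the imaginary unit becomes \<open>rot90\<close>.\<close>

lemma polygon_inside_side:
  obtains s :: real where "s \<in> {1, -1}"
    and "\<And>i x. i < length vs \<Longrightarrow> x \<in> open_segment (vs ! i) (vs ! (Suc i mod length vs)) \<Longrightarrow>
      \<forall>\<^sub>F t in at_right 0.
        x + t *\<^sub>R (s *\<^sub>R rot90 (vs ! (Suc i mod length vs) - vs ! i)) \<in> inside (\<Union>(edges vs)) \<and>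
        x - t *\<^sub>R (s *\<^sub>R rot90 (vs ! (Suc i mod length vs) - vs ! i)) \<notin> region vs"
proof -
  \<comment> \<open>Reducing the index modulo the length treats the closing side like the
    others.\<close>
  define v where "v i = to_complex (vs ! (i mod length vs))" for i
  define U where "U = \<Union>(edges vs)"
  have "3 \<le> length vs" using polygon by (simp add: simple_polygon_def)
  then have "length vs = Suc (Suc (length vs - 2))" by simp
  \<comment> \<open>With k + 2 vertices, \<open>polypath v (Suc k)\<close> has one segment per
    side.\<close>
  then obtain k where k: "length vs = Suc (Suc k)" ..
  have v: "v i = to_complex (vs ! i)" "v (Suc i) = to_complex (vs ! (Suc i mod length vs))"
    if "i \<le> Suc k" for i
    using that by (simp_all add: v_def k)
  have segment: "closed_segment (v i) (v (Suc i)) = to_complex ` side vs i" if "i \<le> Suc k" for i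
    using that by (simp add: v side_def closed_segment_linear_image[OF linear_to_complex])
  have image: "path_image (polypath v (Suc k)) = to_complex ` U"
    unfolding path_image_polypath U_def edges_def k lessThan_Suc_atMost
    using segment by auto
  have "simple_path (polypath v (Suc k))"
  proof (rule simple_path_polypath)
    show "inj_on v {..Suc k}"
      using polygon by (auto simp: inj_on_def v inj_eq[OF inj_to_complex] simple_polygon_def
          nth_eq_iff_index_eq k)
    show "v (Suc (Suc k)) = v 0" by (simp add: v_def k)
    show "closed_segment (v i) (v (Suc i)) \<inter> closed_segment (v j) (v (Suc j))
        \<subseteq> {v i, v (Suc i)} \<inter> {v j, v (Suc j)}" if ij: "i < j" "j \<le> Suc k" for i j
    proof -
      have inter: "side vs i \<inter> side vs j =
          {vs ! i, vs ! (Suc i mod length vs)} \<inter> {vs ! j, vs ! (Suc j mod length vs)}"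
        using ij by (intro sides_Int) (auto simp: k)
      have i: "i \<le> Suc k" using ij by simp
      then have "closed_segment (v i) (v (Suc i)) \<inter> closed_segment (v j) (v (Suc j)) =
          to_complex ` (side vs i \<inter> side vs j)"
        by (simp only: segment[OF i] segment[OF ij(2)] image_Int[OF inj_to_complex])
      also have "\<dots> = {v i, v (Suc i)} \<inter> {v j, v (Suc j)}"
        unfolding inter image_Int[OF inj_to_complex] v[OF i] v[OF ij(2)] by simp
      finally show ?thesis by simp
    qed
  qed
  moreover have "v (Suc (Suc k)) = v 0" by (simp add: v_def k)
  ultimately obtain s where s: "s \<in> {1, -1}" and side: "\<And>i x. i \<le> Suc k \<Longrightarrow>
      x \<in> open_segment (v i) (v (Suc i)) \<Longrightarrow>
      (\<And>j. j \<le> Suc k \<Longrightarrow> j \<noteq> i \<Longrightarrow> x \<notin> closed_segment (v j) (v (Suc j))) \<Longrightarrow>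
      \<forall>\<^sub>F t in at_right 0.
        x + t *\<^sub>R (s *\<^sub>R (\<i> * (v (Suc i) - v i))) \<in> inside (to_complex ` U) \<and>
        x - t *\<^sub>R (s *\<^sub>R (\<i> * (v (Suc i) - v i))) \<in> outside (to_complex ` U)"
    using polypath_inside_side[of v "Suc k"] unfolding image by blast
  have in_inside: "to_complex y \<in> inside (to_complex ` U) \<longleftrightarrow> y \<in> inside U" for y
    by (simp add: inside_to_complex_image inj_image_mem_iff[OF inj_to_complex])
  have in_outside: "to_complex y \<in> outside (to_complex ` U) \<longleftrightarrow> y \<notin> region vs" for y
    by (simp add: outside_inside in_inside inj_image_mem_iff[OF inj_to_complex] region_def flip: U_def)
  interpret to_complex: linear to_complex by (rule linear_to_complex)
  show thesis
  proof (rule that[OF s])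
    fix i x assume i: "i < length vs" and x: "x \<in> open_segment (vs ! i) (vs ! (Suc i mod length vs))"
    let ?n = "s *\<^sub>R rot90 (vs ! (Suc i mod length vs) - vs ! i)"
    have i': "i \<le> Suc k" using i k by simp
    have n: "s *\<^sub>R (\<i> * (v (Suc i) - v i)) = to_complex ?n"
      by (simp add: v[OF i'] to_complex_rot90 to_complex.scaleR to_complex.diff)
    have "\<forall>\<^sub>F t in at_right 0.
        to_complex x + t *\<^sub>R (s *\<^sub>R (\<i> * (v (Suc i) - v i))) \<in> inside (to_complex ` U) \<and>
        to_complex x - t *\<^sub>R (s *\<^sub>R (\<i> * (v (Suc i) - v i))) \<in> outside (to_complex ` U)"
    proof (rule side[OF i'])
      show "to_complex x \<in> open_segment (v i) (v (Suc i))"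
        using x by (simp add: v[OF i'] open_segment_linear_image[OF linear_to_complex inj_to_complex]
            inj_image_mem_iff[OF inj_to_complex])
      show "to_complex x \<notin> closed_segment (v j) (v (Suc j))" if "j \<le> Suc k" "j \<noteq> i" for j
        using open_side_disjoint[OF i _ _ x, of j] that
        by (simp add: segment k inj_image_mem_iff[OF inj_to_complex])
    qed
    then show "\<forall>\<^sub>F t in at_right 0. x + t *\<^sub>R ?n \<in> inside (\<Union>(edges vs)) \<and> x - t *\<^sub>R ?n \<notin> region vs"
      unfolding n to_complex.scaleR[symmetric] to_complex.add[symmetric] to_complex.diff[symmetric]
        in_inside in_outside by (simp add: U_def)
  qed
qed

text \<open>The family is indexed by edges as sets because neighbouring cells share an edge as a
  set, at unrelated positions of their vertex lists.\<close>

lemma polygon_outward_normals: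
  obtains N where "\<And>e. e \<in> edges vs \<Longrightarrow> outward_normal vs e (N e)" "(\<Sum>e\<in>edges vs. N e) = 0"
proof -
  let ?d = "\<lambda>i. vs ! (Suc i mod length vs) - vs ! i"
  obtain s :: real where s: "s \<in> {1, -1}" and side: "\<And>i x. i < length vs \<Longrightarrow>
      x \<in> open_segment (vs ! i) (vs ! (Suc i mod length vs)) \<Longrightarrow>
      \<forall>\<^sub>F t in at_right 0. x + t *\<^sub>R (s *\<^sub>R rot90 (?d i)) \<in> inside (\<Union>(edges vs)) \<and>
        x - t *\<^sub>R (s *\<^sub>R rot90 (?d i)) \<notin> region vs"
    by (rule polygon_inside_side) blast
  \<comment> \<open>The minus sign turns the inward direction of \<open>polygon_inside_side\<close>
    outward.\<close>
  define n where "n i = - (s *\<^sub>R rot90 (?d i))" for i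
  define N where "N e = n (the_inv_into {..<length vs} (side vs) e)" for e
  have N: "N (side vs i) = n i" if "i < length vs" for i
    using that by (simp add: N_def the_inv_into_f_f[OF inj_on_side])
  have outward: "outward_normal vs (side vs i) (n i)" if i: "i < length vs" for i
    unfolding outward_normal_def
  proof (intro conjI ballI)
    show "n i \<bullet> (x - y) = 0" if xy: "x \<in> side vs i" "y \<in> side vs i" for x y
    proof -
      obtain p q where x: "x = (1 - p) *\<^sub>R vs ! i + p *\<^sub>R vs ! (Suc i mod length vs)"
        and y: "y = (1 - q) *\<^sub>R vs ! i + q *\<^sub>R vs ! (Suc i mod length vs)"
        using xy by (auto simp: side_def in_segment)
      have "x - y = (p - q) *\<^sub>R ?d i"
        unfolding x y by (simp add: algebra_simps)
      then show ?thesis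
        by (simp add: n_def inner_rot90)
    qed
    show "norm (n i) = diameter (side vs i)"
      using s by (auto simp: n_def side_def diameter_closed_segment norm_rot90)
    show "\<forall>\<^sub>F t in at_right 0. x + t *\<^sub>R n i \<notin> region vs \<and> x - t *\<^sub>R n i \<in> inside (\<Union>(edges vs))"
      if "x \<in> rel_interior (side vs i)" for x
      using side[OF i, of x] that side_endpoints_ne[OF i]
      by (auto simp: n_def side_def rel_interior_closed_segment conj_commute)
  qed
  \<comment> \<open>The cyclic successor only permutes the vertices: the last index wraps around to
    0.\<close>
  have "(\<Sum>i<length vs. vs ! (Suc i mod length vs)) = (\<Sum>i<length vs. vs ! i)"
  proof -
    obtain m where m: "length vs = Suc m"
      using polygon by (metis Suc_le_D numeral_3_eq_3 simple_polygon_def)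
    then have "(\<Sum>i<m. vs ! (Suc i mod Suc m)) = (\<Sum>i<m. vs ! Suc i)"
      by (intro sum.cong) auto
    with m show ?thesis
      by (subst (2) m, subst sum.lessThan_Suc_shift) (simp add: add.commute)
  qed
  then have "(\<Sum>i<length vs. ?d i) = 0"
    by (simp add: sum_subtractf)
  then have "(\<Sum>i<length vs. n i) = 0"
    by (simp add: n_def sum_negf scaleR_sum_right[symmetric] linear_sum[OF linear_rot90, symmetric]
        linear_0[OF linear_rot90])
  moreover have "(\<Sum>e\<in>edges vs. N e) = (\<Sum>i<length vs. n i)"
    by (simp add: edges_def sum.reindex[OF inj_on_side] N)
  ultimately show thesis
    using outward N by (intro that[of N]) (auto simp: edges_def)
qed

end

section \<open>Edge and corner normals of a tessellation\<close>

text \<open>Stated for orthogonality and length alone, so that it also applies to candidates for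
  \<open>edge_normal\<close>.\<close>

lemma outward_normal_eq_or_opposite:
  assumes polygon: "simple_polygon xs" and e: "e \<in> edges xs"
    and m: "\<forall>x\<in>e. \<forall>y\<in>e. m \<bullet> (x - y) = 0" "norm m = diameter e"
    and n: "\<forall>x\<in>e. \<forall>y\<in>e. n \<bullet> (x - y) = 0" "norm n = diameter e"
  shows "m = n \<or> m = - n"
proof -
  obtain i where i: "i < length xs" "e = side xs i"
    using e by (auto simp: edges_def)
  let ?a = "xs ! i" and ?b = "xs ! (Suc i mod length xs)"
  have "?a \<in> e" "?b \<in> e" by (simp_all add: i side_def)
  then show ?thesis
    using side_endpoints_ne[OF polygon i(1)] m n
    by (intro orthogonal_real2_unique[of "?b - ?a"]) auto
qed

lemma rel_interior_edge_nonempty: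
  assumes "simple_polygon xs" "e \<in> edges xs"
  shows "rel_interior e \<noteq> {}"
  using assms by (auto simp: edges_def side_def rel_interior_eq_empty)

text \<open>If the normals were equal, points just behind the edge would be inside both polygons,
  hence in both interiors.\<close>

lemma outward_normals_opposite:
  assumes "simple_polygon xs" "simple_polygon ys"
    and disjoint: "interior (region xs) \<inter> interior (region ys) = {}"
    and e: "e \<in> edges xs" and m: "outward_normal xs e m" and n: "outward_normal ys e n"
  shows "n = - m"
proof (rule ccontr)
  assume "n \<noteq> - m"
  then have "n = m"
    using outward_normal_eq_or_opposite[OF assms(1) e, of n m] m n by (auto simp: outward_normal_def)
  obtain x where x: "x \<in> rel_interior e"
    using rel_interior_edge_nonempty[OF assms(1) e] by auto
  have "\<forall>\<^sub>F t in at_right (0::real). x - t *\<^sub>R m \<in> inside (\<Union>(edges xs)) \<inter> inside (\<Union>(edges ys))"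
    using outward_normal_eventually(1)[OF m x] outward_normal_eventually(1)[OF n x] \<open>n = m\<close>
    by (simp add: eventually_conj_iff)
  then obtain y where "y \<in> inside (\<Union>(edges xs))" "y \<in> inside (\<Union>(edges ys))"
    using eventually_happens'[OF trivial_limit_at_right_real] by blast
  moreover have "inside (\<Union>(edges zs)) \<subseteq> interior (region zs)" if "simple_polygon zs" for zs
    by (rule interior_maximal) (auto simp: region_def open_inside_polygon[OF that])
  ultimately show False
    using assms(1,2) disjoint by blast
qed

text \<open>Existence: the outward normal of \<open>a\<close> is \<open>- n\<close>, so
  \<open>n\<close> leads from \<open>c\<close> into \<open>a\<close>. Uniqueness: the only other
  candidate is \<open>- n\<close>, and a step against it leaves \<open>c\<close>.\<close>

lemma edge_normal_eq_outward_normal: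
  assumes "simple_polygon (vs a)" "simple_polygon (vs c)"
    and disjoint: "interior (region (vs a)) \<inter> interior (region (vs c)) = {}"
    and e: "e \<in> edges (vs a)" "e \<in> edges (vs c)" and n: "outward_normal (vs c) e n"
  shows "edge_normal vs e a c = n"
  unfolding edge_normal_def
proof (rule the_equality)
  obtain m where m: "outward_normal (vs a) e m"
    using polygon_outward_normals[OF assms(1)] e(1) by metis
  \<comment> \<open>If both cells lay on the same side of \<^term>\<open>e\<close>, they would overlap.\<close>
  have "m = - n"
    using outward_normals_opposite[OF assms(2,1) _ e(2) n m] disjoint by auto
  have "\<forall>\<^sub>F t in at_right (0::real). x + t *\<^sub>R n \<in> region (vs a) \<and> x - t *\<^sub>R n \<in> region (vs c)"
    if x: "x \<in> rel_interior e" for x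
  proof -
    have "\<forall>\<^sub>F t in at_right (0::real). x - t *\<^sub>R m \<in> inside (\<Union>(edges (vs a)))"
      by (rule outward_normal_eventually[OF m x])
    moreover have "\<forall>\<^sub>F t in at_right (0::real). x - t *\<^sub>R n \<in> inside (\<Union>(edges (vs c)))"
      by (rule outward_normal_eventually[OF n x])
    ultimately show ?thesis
      by eventually_elim (simp add: region_def \<open>m = - n\<close>)
  qed
  with n show "(\<forall>x\<in>e. \<forall>y\<in>e. n \<bullet> (x - y) = 0) \<and> norm n = diameter e \<and>
      (\<forall>x\<in>rel_interior e. \<forall>\<^sub>F t in at_right 0.
        x + t *\<^sub>R n \<in> region (vs a) \<and> x - t *\<^sub>R n \<in> region (vs c))"
    by (simp add: outward_normal_def)
next
  fix k assume k: "(\<forall>x\<in>e. \<forall>y\<in>e. k \<bullet> (x - y) = 0) \<and> norm k = diameter e \<and>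
      (\<forall>x\<in>rel_interior e. \<forall>\<^sub>F t in at_right 0.
        x + t *\<^sub>R k \<in> region (vs a) \<and> x - t *\<^sub>R k \<in> region (vs c))"
  show "k = n"
  proof (rule ccontr)
    assume "k \<noteq> n"
    then have "k = - n"
      using outward_normal_eq_or_opposite[OF assms(2) e(2), of k n] k n by (auto simp: outward_normal_def)
    obtain x where x: "x \<in> rel_interior e"
      using rel_interior_edge_nonempty[OF assms(1) e(1)] by auto
    have "\<forall>\<^sub>F t in at_right (0::real). x - t *\<^sub>R k \<in> region (vs c)"
      using k x by (auto elim: eventually_mono)
    moreover have "\<forall>\<^sub>F t in at_right (0::real). x + t *\<^sub>R n \<notin> region (vs c)"
      by (rule outward_normal_eventually[OF n x])
    ultimately have "\<forall>\<^sub>F t in at_right (0::real). False"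
      by eventually_elim (simp add: \<open>k = - n\<close>)
    then show False by simp
  qed
qed

section \<open>Sum of the corner normals of a cell\<close>

lemma (in polygonal_tessellation) sum_corner_normal_eq_0:
  "(\<Sum>p\<in>set (vs c). corner_normal vs p c) = 0"
proof -
  obtain N where N: "\<And>e. e \<in> edges (vs c) \<Longrightarrow> outward_normal (vs c) e (N e)"
    and closed: "(\<Sum>e\<in>edges (vs c). N e) = 0"
    using polygon_outward_normals[OF polygon] by metis
  have normal: "edge_normal vs e a c = N e" if "a \<noteq> c" "e \<in> edges (vs a)" "e \<in> edges (vs c)" for a e
    by (rule edge_normal_eq_outward_normal)
       (use that N polygon non_overlapping in auto)
  have corner: "corner_normal vs p c = (1/2) *\<^sub>R (\<Sum>e\<in>{e \<in> edges (vs c). p \<in> e}. N e)" for p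
  proof -
    \<comment> \<open>By \<open>edge_to_edge\<close> the cell \<open>a\<close> in a pair
      \<open>(a, e)\<close> is determined by \<open>e\<close>, so the sum over pairs is a sum over
      the edges of \<open>c\<close> at \<open>p\<close>.\<close>
    define neighbour where "neighbour e = (THE a. a \<noteq> c \<and> e \<in> edges (vs a))" for e
    have neighbour: "neighbour e \<noteq> c" "e \<in> edges (vs (neighbour e))" if "e \<in> edges (vs c)" for e
      using theI'[OF edge_to_edge[OF that]] by (simp_all add: neighbour_def)
    have unique: "neighbour e = a" if "a \<noteq> c" "e \<in> edges (vs a)" "e \<in> edges (vs c)" for a e
      using the1_equality[OF edge_to_edge[OF that(3)]] that by (simp add: neighbour_def)
    have "(\<Sum>(a, e) \<in> {(a, e). a \<noteq> c \<and> e \<in> edges (vs a) \<inter> edges (vs c) \<and> p \<in> e}. edge_normal vs e a c) =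
        (\<Sum>e\<in>{e \<in> edges (vs c). p \<in> e}. N e)"
      by (rule sum.reindex_bij_witness[where i = "\<lambda>e. (neighbour e, e)" and j = snd])
         (auto simp: neighbour unique normal)
    then show ?thesis
      by (simp add: corner_normal_def)
  qed
  \<comment> \<open>Incident pairs of a corner and an edge are counted in both orders.\<close>
  have "(\<Sum>p\<in>set (vs c). \<Sum>e\<in>{e \<in> edges (vs c). p \<in> e}. N e) =
      (\<Sum>e\<in>edges (vs c). \<Sum>p\<in>{p \<in> set (vs c). p \<in> e}. N e)"
    by (rule sum.swap_restrict) (simp_all add: finite_edges)
  also have "\<dots> = (\<Sum>e\<in>edges (vs c). 2 *\<^sub>R N e)"
    using card_vertices_on_edge[OF polygon] by (intro sum.cong) (simp_all add: sum_constant_scaleR del: sum_constant)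
  also have "\<dots> = 0"
    using closed by (simp add: scaleR_sum_right[symmetric])
  finally show ?thesis
    by (simp add: corner scaleR_sum_right[symmetric])
qed

section \<open>Comparison of the two schemes\<close>

text \<open>The relation between fluxes and fluctuations is assumed for cells in
  \<open>cells_at\<close>, whereas the update sums over the vertex list of a cell.\<close>

lemma vertex_in_cells_at:
  assumes "p \<in> set (vs c)"
  shows "c \<in> cells_at vs p"
proof -
  obtain i where "i < length (vs c)" "p = vs c ! i"
    using assms by (auto simp: in_set_conv_nth)
  then have "p \<in> side (vs c) i" "side (vs c) i \<in> edges (vs c)"
    by (auto simp: side_def edges_def)
  then show ?thesis
    by (auto simp: cells_at_def region_def)
qed

lemma linear_flux_dot: "linear ((\<bullet>\<^sub>F) A)"
  by (rule linearI)
     (simp_all add: flux_dot_def scaleR_add_left sum.distrib scaleR_sum_right)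

theorem mainTheorem2:
  fixes vs :: "'c \<Rightarrow> (real^2) list"
    and \<Omega>\<^sub>Q :: "(real^'m) set"
    and F :: "real^'m \<Rightarrow> real^'m^2"
    and Q :: "'c \<Rightarrow> real^'m"
    and \<Delta>t :: real
    and Fhat \<phi> :: "real^2 \<Rightarrow> 'c \<Rightarrow> real^'m"
  assumes "polygonal_tessellation vs"
    and "hyperbolic_system \<Omega>\<^sub>Q F"
    and "\<And>c. Q c \<in> \<Omega>\<^sub>Q"
    and "\<Delta>t > 0"
    and "\<And>p c. p \<in> vertices vs \<Longrightarrow> c \<in> cells_at vs p \<Longrightarrow>
           Fhat p c = F (Q c) \<bullet>\<^sub>F corner_normal vs p c + \<phi> p c"
  shows "(\<forall>p\<in>vertices vs.
            (\<Sum>c\<in>cells_at vs p. Fhat p c) = 0 \<longleftrightarrow>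
            (\<Sum>c\<in>cells_at vs p. \<phi> p c) = residual vs F Q p) \<and>
         (\<forall>c. Q c - (\<Delta>t / area vs c) *\<^sub>R (\<Sum>p\<in>set (vs c). Fhat p c) =
              Q c - (\<Delta>t / area vs c) *\<^sub>R (\<Sum>p\<in>set (vs c). \<phi> p c))"
proof (intro conjI ballI allI)
  fix p assume p: "p \<in> vertices vs"
  \<comment> \<open>The residual is formed with the opposite corner normals, so it is minus the
    physical part of the sum of the corner fluxes.\<close>
  have "residual vs F Q p = - (\<Sum>c\<in>cells_at vs p. F (Q c) \<bullet>\<^sub>F corner_normal vs p c)"
    by (simp add: residual_def corner_normal'_def linear_neg[OF linear_flux_dot] sum_negf)
  moreover have "(\<Sum>c\<in>cells_at vs p. Fhat p c) =
      (\<Sum>c\<in>cells_at vs p. F (Q c) \<bullet>\<^sub>F corner_normal vs p c) + (\<Sum>c\<in>cells_at vs p. \<phi> p c)"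
    using assms(5)[OF p] by (simp add: sum.distrib)
  ultimately show "(\<Sum>c\<in>cells_at vs p. Fhat p c) = 0 \<longleftrightarrow>
      (\<Sum>c\<in>cells_at vs p. \<phi> p c) = residual vs F Q p"
    by (metis add_eq_0_iff)
next
  fix c
  have "Fhat p c = F (Q c) \<bullet>\<^sub>F corner_normal vs p c + \<phi> p c" if "p \<in> set (vs c)" for p
    using that by (intro assms(5) vertex_in_cells_at) (auto simp: vertices_def)
  \<comment> \<open>The state \<open>Q c\<close> is the same at all corners of the cell, so by
    linearity its flux is applied to the sum of the corner normals.\<close>
  then have "(\<Sum>p\<in>set (vs c). Fhat p c) =
      F (Q c) \<bullet>\<^sub>F (\<Sum>p\<in>set (vs c). corner_normal vs p c) + (\<Sum>p\<in>set (vs c). \<phi> p c)"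
    by (simp add: sum.distrib linear_sum[OF linear_flux_dot])
  then show "Q c - (\<Delta>t / area vs c) *\<^sub>R (\<Sum>p\<in>set (vs c). Fhat p c) =
      Q c - (\<Delta>t / area vs c) *\<^sub>R (\<Sum>p\<in>set (vs c). \<phi> p c)"
    by (simp add: polygonal_tessellation.sum_corner_normal_eq_0[OF assms(1)] linear_0[OF linear_flux_dot])
qed

end
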